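(* Let $X$ be a proper metric space, and let $\mathcal{A}\subset H(X)$ be a nonempty finite subset. Then $\Sigma(\mathcal{A})$ is not empty.
   Context: A metric space is proper if every closed bounded subset of it is compact. For a metric space $X$, $H(X)$ denotes the set of all nonempty compact subsets of $X$ endowed with the Hausdorff distance $d_H$. For a finite set $\mathcal{A}=\{A_1,\dots,A_n\}\subset H(X)$ and $K\in H(X)$ put $S_{\mathcal{A}}(K)=\sum_{i=1}^n d_H(K,A_i)$. $\Sigma(\mathcal{A})$ is the set of all $K\in H(X)$ at which $S_{\mathcal{A}}$ attains its minimum over $H(X)$. *)

theory Defs
  imports "HOL-Analysis.Analysis"
begin

definition proper_metric :: "'a::metric_space itself \<Rightarrow> bool" where
  "proper_metric _ \<longleftrightarrow> (\<forall>S::'a set. closed S \<and> bounded S \<longrightarrow> compact S)"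

definition hyperspace :: "'a::metric_space set set" where
  "hyperspace = {K. compact K \<and> K \<noteq> {}}"

text \<open>
  Only meaningful for nonempty bounded arguments, in particular on
  \<^const>\<open>hyperspace\<close>: there both suprema range over nonempty sets that are
  bounded above.
\<close>
definition hausdorff_dist :: "'a::metric_space set \<Rightarrow> 'a set \<Rightarrow> real" where
  "hausdorff_dist A B = max (SUP a\<in>A. infdist a B) (SUP b\<in>B. infdist b A)"

definition dist_sum :: "'a::metric_space set set \<Rightarrow> 'a set \<Rightarrow> real" where
  "dist_sum \<A> K = (\<Sum>A\<in>\<A>. hausdorff_dist K A)"

definition minimizers :: "'a::metric_space set set \<Rightarrow> 'a set set" where
  "minimizers \<A> = {K \<in> hyperspace. \<forall>L\<in>hyperspace. dist_sum \<A> K \<le> dist_sum \<A> L}"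

end

theory Submission
  imports Defs
begin

text \<open>
  The inequality \<open>d\<^sub>H(K, A) \<le> r\<close> splits into two halves of opposite monotonicity: \<open>K\<close> has to lie in the
  closed \<open>r\<close>-neighbourhood of \<open>A\<close>, which favours small \<open>K\<close>, and every point of \<open>A\<close> has to lie within
  \<open>r\<close> of \<open>K\<close>, which favours large \<open>K\<close>. Hence for prescribed radii \<open>r A\<close>, one for each \<open>A \<in> \<A>\<close>, there is
  a canonical candidate, namely the largest set that the first half permits:
  \<open>K = {x. \<forall>A\<in>\<A>. infdist x A \<le> r A}\<close>. It is closed and bounded, hence compact when the space is proper.

  Let \<open>L n\<close> be a minimizing sequence for \<^term>\<open>dist_sum \<A>\<close>. Its finitely many distances
  \<^term>\<open>hausdorff_dist (L n) A\<close> are bounded, so along a subsequence they converge to radii \<open>r A\<close> whose sum is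
  the infimum. The canonical set for these radii also satisfies the second half: for \<open>a \<in> A\<close>, points of
  \<open>L n\<close> nearest to \<open>a\<close> stay in a compact ball around \<open>a\<close>, and each of their cluster points is a
  point of \<open>K\<close> within \<open>r A\<close> of \<open>a\<close> (\<open>limit_radii_attained\<close>). So \<open>K\<close> is a minimizer.
  Only distances and points converge in this argument, never the sets \<open>L n\<close>, so no compactness
  theorem for the Hausdorff metric itself enters.
\<close>

lemma infdist_attained_compact:
  fixes A :: "'a::metric_space set"
  assumes "compact A" "A \<noteq> {}"
  obtains y where "y \<in> A" "dist x y = infdist x A"
proof -
  have "continuous_on A (dist x)"
    by (intro continuous_intros)
  then obtain y where y: "y \<in> A" "\<forall>z\<in>A. dist x y \<le> dist x z"
    using continuous_attains_inf[OF assms] by blast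
  have "dist x y \<le> infdist x A"
    using y assms(2) by (auto simp: infdist_notempty intro!: cINF_greatest)
  with infdist_le[OF y(1), of x] y(1) that show thesis
    by force
qed

lemma bounded_infdist_le:
  fixes A :: "'a::metric_space set"
  assumes "compact A" "A \<noteq> {}"
  shows "bounded {x. infdist x A \<le> e}"
proof -
  obtain z b where b: "\<And>y. y \<in> A \<Longrightarrow> dist z y \<le> b"
    using compact_imp_bounded[OF assms(1)] by (auto simp: bounded_def)
  have "dist z x \<le> b + e" if "infdist x A \<le> e" for x
  proof -
    obtain y where "y \<in> A" "dist x y = infdist x A"
      using infdist_attained_compact[OF assms] by blast
    with b[of y] that dist_triangle2[of z x y] show ?thesis
      by simp
  qed
  then show ?thesis
    by (auto simp: bounded_def)
qed

text \<open>
  Compactness of both sets bounds the two suprema in the definition of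
  \<^const>\<open>hausdorff_dist\<close>; on \<^const>\<open>hyperspace\<close> all reasoning about it goes through this splitting.
\<close>
lemma hausdorff_dist_le_iff:
  fixes A B :: "'a::metric_space set"
  assumes "A \<in> hyperspace" "B \<in> hyperspace"
  shows "hausdorff_dist A B \<le> r \<longleftrightarrow> (\<forall>a\<in>A. infdist a B \<le> r) \<and> (\<forall>b\<in>B. infdist b A \<le> r)"
proof -
  have bdd: "bdd_above ((\<lambda>x. infdist x D) ` C)" if "C \<in> hyperspace" for C D :: "'a set"
  proof -
    have "compact ((\<lambda>x. infdist x D) ` C)"
      using that by (intro compact_continuous_image continuous_intros) (simp add: hyperspace_def)
    then show ?thesis
      by (intro bounded_imp_bdd_above compact_imp_bounded)
  qed
  show ?thesis
    using assms bdd[OF assms(1)] bdd[OF assms(2)]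
    by (simp add: hausdorff_dist_def cSUP_le_iff hyperspace_def)
qed

lemma hausdorff_dist_nonneg:
  assumes "A \<in> hyperspace" "B \<in> hyperspace"
  shows "0 \<le> hausdorff_dist A B"
proof -
  obtain a where "a \<in> A"
    using assms(1) by (auto simp: hyperspace_def)
  then have "infdist a B \<le> hausdorff_dist A B"
    using hausdorff_dist_le_iff[OF assms, of "hausdorff_dist A B"] by simp
  with infdist_nonneg[of a B] show ?thesis
    by linarith
qed

lemma dist_sum_nonneg:
  assumes "\<A> \<subseteq> hyperspace" "K \<in> hyperspace"
  shows "0 \<le> dist_sum \<A> K"
  unfolding dist_sum_def using assms by (auto intro!: sum_nonneg hausdorff_dist_nonneg)

text \<open>
  Upper bounds on the distances to the members of \<open>\<A>\<close> survive passing to the limit although the sets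
  \<open>L n\<close> need not converge: the witness is the largest set that lies in all the neighbourhoods
  prescribed by the limit radii.
\<close>
lemma limit_radii_attained:
  fixes \<A> :: "'a::metric_space set set"
  assumes proper: "proper_metric TYPE('a)"
    and ne: "\<A> \<noteq> {}" and hyp: "\<A> \<subseteq> hyperspace"
    and L: "\<And>n. L n \<in> hyperspace"
    and lim: "\<And>A. A \<in> \<A> \<Longrightarrow> (\<lambda>n. hausdorff_dist (L n) A) \<longlonglongrightarrow> r A"
  obtains K where "K \<in> hyperspace" "\<And>A. A \<in> \<A> \<Longrightarrow> hausdorff_dist K A \<le> r A"
proof -
  define K where "K = {x. \<forall>A\<in>\<A>. infdist x A \<le> r A}"
  have near: "infdist x A \<le> hausdorff_dist (L n) A" if "x \<in> L n" "A \<in> \<A>" for x n A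
    using hausdorff_dist_le_iff[OF L, of A n "hausdorff_dist (L n) A"] that hyp by auto
  have far: "infdist a (L n) \<le> hausdorff_dist (L n) A" if "a \<in> A" "A \<in> \<A>" for a n A
    using hausdorff_dist_le_iff[OF L, of A n "hausdorff_dist (L n) A"] that hyp by auto

  have close: "\<exists>k\<in>K. dist a k \<le> r A" if "a \<in> A" and A: "A \<in> \<A>" for a A
  proof -
    have "\<exists>k\<in>L n. dist a k = infdist a (L n)" for n
      using infdist_attained_compact[of "L n" a] L[of n] by (auto simp: hyperspace_def)
    then obtain k where k: "\<And>n. k n \<in> L n" "\<And>n. dist a (k n) = infdist a (L n)"
      by metis
    have dk: "dist a (k n) \<le> hausdorff_dist (L n) A" for n
      using far[OF that] k(2) by simp
    obtain C where C: "\<And>n. hausdorff_dist (L n) A \<le> C"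
      using convergent_imp_Bseq[OF convergentI[OF lim[OF A]]] by (auto simp: Bseq_def abs_le_iff)
    have "compact (cball a C)"
      using proper by (simp add: proper_metric_def)
    moreover have "\<forall>n. k n \<in> cball a C"
      using order_trans[OF dk C] by simp
    ultimately obtain l s where s: "strict_mono s" and l: "(k \<circ> s) \<longlonglongrightarrow> l"
      by (meson compact_imp_seq_compact seq_compactE)
    have lim_s: "(\<lambda>n. hausdorff_dist (L (s n)) B) \<longlonglongrightarrow> r B" if "B \<in> \<A>" for B
      using LIMSEQ_subseq_LIMSEQ[OF lim[OF that] s] by (simp add: o_def)
    have "infdist l B \<le> r B" if "B \<in> \<A>" for B
    proof (rule LIMSEQ_le[OF tendsto_infdist[OF l] lim_s[OF that]])
      show "\<exists>N. \<forall>n\<ge>N. infdist ((k \<circ> s) n) B \<le> hausdorff_dist (L (s n)) B"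
        using near[OF k(1) that] by auto
    qed
    moreover have "dist a l \<le> r A"
    proof (rule LIMSEQ_le[OF tendsto_dist[OF tendsto_const l] lim_s[OF A]])
      show "\<exists>N. \<forall>n\<ge>N. dist a ((k \<circ> s) n) \<le> hausdorff_dist (L (s n)) A"
        using dk by auto
    qed
    ultimately show ?thesis
      by (auto simp: K_def)
  qed

  obtain A0 where A0: "A0 \<in> \<A>" "compact A0" "A0 \<noteq> {}"
    using ne hyp by (auto simp: hyperspace_def)
  have "K \<noteq> {}"
    using close A0 by blast
  moreover have "compact K"
  proof -
    have "closed {x. infdist x A \<le> r A}" for A
      by (intro closed_Collect_le continuous_intros)
    then have "closed K"
      by (auto simp: K_def Collect_ball_eq intro!: closed_INT)
    moreover have "bounded K"
      by (rule bounded_subset[OF bounded_infdist_le[OF A0(2,3), of "r A0"]])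
        (use A0(1) in \<open>auto simp: K_def\<close>)
    ultimately show ?thesis
      using proper by (simp add: proper_metric_def)
  qed
  ultimately have K: "K \<in> hyperspace"
    by (simp add: hyperspace_def)
  have "hausdorff_dist K A \<le> r A" if "A \<in> \<A>" for A
  proof -
    have "infdist a K \<le> r A" if "a \<in> A" for a
      using close[OF that \<open>A \<in> \<A>\<close>] by (auto intro: infdist_le2)
    moreover have "A \<in> hyperspace"
      using hyp that by blast
    ultimately show ?thesis
      using hausdorff_dist_le_iff[OF K, of A "r A"] that by (auto simp: K_def)
  qed
  with K that show thesis
    by blast
qed

text \<open>Bolzano--Weierstrass for families of real sequences over a finite index set.\<close>
lemma common_convergent_subsequence:
  fixes f :: "nat \<Rightarrow> 'i \<Rightarrow> real"
  assumes "finite I" and "\<And>i. i \<in> I \<Longrightarrow> bounded (range (\<lambda>n. f n i))"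
  obtains l s where "strict_mono s" "\<And>i. i \<in> I \<Longrightarrow> (\<lambda>n. f (s n) i) \<longlonglongrightarrow> l i"
proof -
  have "\<forall>J\<subseteq>I. \<exists>l::'i \<Rightarrow> real. \<exists>s::nat \<Rightarrow> nat. strict_mono s \<and>
      (\<forall>\<epsilon>>0. eventually (\<lambda>n. \<forall>i\<in>J. dist (f (s n) i) (l i) < \<epsilon>) sequentially)"
    by (rule compact_lemma_general[where proj = "\<lambda>x i. x i" and unproj = "\<lambda>x. x"])
      (use assms in \<open>auto simp: image_image\<close>)
  then obtain l s where s: "strict_mono s" and
    l: "\<And>\<epsilon>. \<epsilon> > 0 \<Longrightarrow> eventually (\<lambda>n. \<forall>i\<in>I. dist (f (s n) i) (l i) < \<epsilon>) sequentially"
    by blast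
  have "(\<lambda>n. f (s n) i) \<longlonglongrightarrow> l i" if "i \<in> I" for i
  proof (rule tendstoI)
    fix \<epsilon> :: real assume "\<epsilon> > 0"
    from l[OF this] show "eventually (\<lambda>n. dist (f (s n) i) (l i) < \<epsilon>) sequentially"
      by eventually_elim (use that in blast)
  qed
  with s that show thesis
    by blast
qed

theorem corollary1p9:
  fixes \<A> :: "'a::metric_space set set"
  assumes "proper_metric TYPE('a)"
    and "finite \<A>" and "\<A> \<noteq> {}" and "\<A> \<subseteq> hyperspace"
  shows "minimizers \<A> \<noteq> {}"
proof -
  let ?H = "hyperspace :: 'a set set"
  define m where "m = (INF K\<in>?H. dist_sum \<A> K)"
  have bdd: "bdd_below (dist_sum \<A> ` ?H)"
    using dist_sum_nonneg[OF assms(4)] by (auto intro!: bdd_belowI[of _ 0])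
  have "?H \<noteq> {}"
    using assms(3,4) by blast
  then have "\<exists>K\<in>?H. dist_sum \<A> K < m + inverse (real (Suc n))" for n
    using cINF_less_iff[OF _ bdd, of "m + inverse (real (Suc n))"]
    by (simp add: m_def add_pos_nonneg del: of_nat_Suc)
  then obtain L where L: "\<And>n. L n \<in> ?H"
    and L_less: "\<And>n. dist_sum \<A> (L n) < m + inverse (real (Suc n))"
    by metis
  have "bounded (range (\<lambda>n. hausdorff_dist (L n) A))" if "A \<in> \<A>" for A
  proof -
    have "hausdorff_dist (L n) A \<in> {0..m + 1}" for n
    proof -
      have nonneg: "0 \<le> hausdorff_dist (L n) B" if "B \<in> \<A>" for B
        using hausdorff_dist_nonneg[OF L] that assms(4) by blast
      have "hausdorff_dist (L n) A \<le> dist_sum \<A> (L n)"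
        unfolding dist_sum_def using that nonneg assms(2) by (intro member_le_sum) auto
      also have "\<dots> \<le> m + 1"
        using L_less[of n] inverse_le_1_iff[of "real (Suc n)"] by simp
      finally show ?thesis
        using nonneg[OF that] by simp
    qed
    then show ?thesis
      by (intro bounded_subset[OF bounded_closed_interval]) blast
  qed
  then obtain r s where s: "strict_mono s"
    and r: "\<And>A. A \<in> \<A> \<Longrightarrow> (\<lambda>n. hausdorff_dist (L (s n)) A) \<longlonglongrightarrow> r A"
    using common_convergent_subsequence[OF assms(2), of "\<lambda>n. hausdorff_dist (L n)"] by blast
  have "(\<Sum>A\<in>\<A>. r A) \<le> m"
  proof (rule LIMSEQ_le)
    show "(\<lambda>n. dist_sum \<A> (L (s n))) \<longlonglongrightarrow> (\<Sum>A\<in>\<A>. r A)"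
      unfolding dist_sum_def by (intro tendsto_sum r)
    show "(\<lambda>n. m + inverse (real (Suc (s n)))) \<longlonglongrightarrow> m"
      using LIMSEQ_subseq_LIMSEQ[OF LIMSEQ_inverse_real_of_nat_add s] by (simp add: o_def)
    show "\<exists>N. \<forall>n\<ge>N. dist_sum \<A> (L (s n)) \<le> m + inverse (real (Suc (s n)))"
      using L_less less_imp_le by blast
  qed
  moreover obtain K where K: "K \<in> ?H" "\<And>A. A \<in> \<A> \<Longrightarrow> hausdorff_dist K A \<le> r A"
    using limit_radii_attained[OF assms(1,3,4) L r] by blast
  then have "dist_sum \<A> K \<le> (\<Sum>A\<in>\<A>. r A)"
    unfolding dist_sum_def by (intro sum_mono)
  ultimately have "dist_sum \<A> K \<le> m"
    by linarith
  moreover have "m \<le> dist_sum \<A> M" if "M \<in> ?H" for M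
    unfolding m_def using cINF_lower[OF bdd that] .
  ultimately have "K \<in> minimizers \<A>"
    using K(1) by (force simp: minimizers_def)
  then show ?thesis
    by blast
qed

end
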